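(* Let $F:\mathcal X\to\mathcal E$ be differentiable, $x\in\mathcal X$, $Q$ a linear connection map on $\mathcal E$, and $\alpha\in(0,1]$. Let $Q_{F(x)}\circ F'(x)$ be invertible and let $\delta x\in T_x\mathcal X$ be the Newton direction at $x$, i.e. $Q_{F(x)}\circ F'(x)\delta x+F(x)=0_{y(x)}$. Consider the Newton path problem with starting point $x(0)=x$ and vector back-transport $V_{y(0)}$, where $y(0)=y(x)$, and assume that $V_{y(0)}$ is consistent with $Q$ at $e=F(x)$. Then the damped Newton direction $\alpha\,\delta x$ coincides with the first Newton direction $\delta x^\alpha$ of the Newton path problem. Moreover, it is tangent to the algebraic Newton path $x(\cdot)$ and to the differential Newton path $x_d(\cdot)$ starting at $x(0)=x_d(0)=x$ (whenever these are defined near $0$ and differentiable at $0$). In particular, $$\alpha\,\delta x=\delta x^\alpha=\alpha\,x'(0)=\alpha\,x_d'(0).$$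
   Context: **Manifolds and bundles.** $\mathcal X,\mathcal Y$ are $C^1$-Banach manifolds; $p:\mathcal E\to\mathcal Y$ is a $C^1$ vector bundle with fibres $E_y=p^{-1}(y)$, zero elements $0_y$, and local trivializations $\tau:p^{-1}(U)\to U\times\mathbb E$, $e\mapsto(p(e),e_\tau)$, $e_\tau=\tau_{p(e)}e$, with $\mathbb E$ a Banach space and $\tau_y\in L(E_y,\mathbb E)$ isomorphisms. Put $y(x):=p(F(x))$. **Connection map.** $Q$ assigns to every $e\in\mathcal E$ a continuous linear $Q_e:T_e\mathcal E\to E_{p(e)}$ with $Q_e\kappa_e=Id$, where $\kappa_ew=\frac d{dt}(e+tw)|_{t=0}$ for $w\in E_{p(e)}$. It is linear if $Q\circ m_s'=m_s\circ Q$ for all $s\in\mathbb R$, where $m_s:\mathcal E\to\mathcal E$, $m_s(e)=se$. **Vector back-transport.** $V_y$ assigns to each $\hat y\in\mathcal Y$ an invertible $V_y(\hat y)\in L(E_{\hat y},E_y)$ with $V_y(y)=Id_{E_y}$, and is differentiable, i.e. $\hat y\mapsto\tau_yV_y(\hat y)\tau_{\hat y}^{-1}\in L(\mathbb E,\mathbb E)$ is differentiable in local trivializations. Put $\langle V_y\rangle:\mathcal E\to E_y$, $\langle V_y\rangle(e)=V_y(p(e))e$. $V_y$ is consistent with $Q$ at $e\in E_y$ if $Q_e=\langle V_y\rangle'(e)$. **Newton paths.** The Newton path problem with starting point $x(0)$ is: find $x(\alpha)\in\mathcal X$ with $$\langle V_{y(0)}\rangle(F(x(\alpha)))=(1-\alpha)F(x(0)),\qquad\alpha\in[0,1],$$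 where $y(0)=p(F(x(0)))$. The mapping $\alpha\mapsto x(\alpha)$, where defined, is the algebraic Newton path. The first (simplified) Newton direction $\delta x^\alpha\in T_{x(0)}\mathcal X$ of the Newton path problem is the solution of $$\langle V_{y(0)}\rangle'(F(x(0)))F'(x(0))\,\delta x^\alpha+\alpha F(x(0))=0 .$$ The differential Newton path is the trajectory of $Q_{F(x_d(\alpha))}\circ F'(x_d(\alpha))\,x_d'(\alpha)+F(x_d(\alpha))=0$ with $x_d(0)=x(0)$. *)

theory Defs
  imports "HOL-Analysis.Analysis"
begin

subsection \<open>Banach manifolds of class $C^1$\<close>

text \<open>
  A chart is a pair \<open>(U, \<phi>)\<close>; the values of \<open>\<phi>\<close> outside \<open>U\<close> are irrelevant.  A manifold is a type
  \<open>'x\<close> with its topology, together with an atlas of charts into a Banach space \<open>'a\<close>.  As in Lang's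
  book, neither the Hausdorff property nor second countability is required.
\<close>

type_synonym ('x, 'a) chart = "'x set \<times> ('x \<Rightarrow> 'a)"

definition chart_inv :: "('x, 'a) chart \<Rightarrow> 'a \<Rightarrow> 'x" where
  "chart_inv c = inv_into (fst c) (snd c)"

definition C1_on :: "'a::real_normed_vector set \<Rightarrow> ('a \<Rightarrow> 'b::real_normed_vector) \<Rightarrow> bool" where
  "C1_on S f \<longleftrightarrow> (\<exists>f'. (\<forall>z\<in>S. (f has_derivative blinfun_apply (f' z)) (at z)) \<and> continuous_on S f')"

definition C1_atlas :: "('x::topological_space, 'a::banach) chart set \<Rightarrow> bool" where
  "C1_atlas A \<longleftrightarrow>
     (\<Union>c\<in>A. fst c) = UNIV \<and>
     (\<forall>c\<in>A. open (fst c) \<and> open (snd c ` fst c) \<and>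
        homeomorphism (fst c) (snd c ` fst c) (snd c) (chart_inv c)) \<and>
     (\<forall>c\<in>A. \<forall>d\<in>A. C1_on (snd c ` (fst c \<inter> fst d)) (snd d \<circ> chart_inv c))"

definition C1_into ::
  "('x, 'a::banach) chart set \<Rightarrow> 'x set \<Rightarrow> ('x \<Rightarrow> 'b::real_normed_vector) \<Rightarrow> bool" where
  "C1_into A S f \<longleftrightarrow> (\<forall>c\<in>A. C1_on (snd c ` (fst c \<inter> S)) (f \<circ> chart_inv c))"

text \<open>
  A tangent vector at \<open>x\<close> is an equivalence class of pairs (chart around \<open>x\<close>, vector of the model
  space), where \<open>(c, a)\<close> and \<open>(d, b)\<close> are equivalent iff the derivative of the change of charts at
  \<open>x\<close> sends \<open>a\<close> to \<open>b\<close>.  Such a class contains exactly one pair for every chart around \<open>x\<close>, so it is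
  represented by the function sending each chart to the corresponding vector, with the value \<open>0\<close>
  for all other pairs.  The vector space operations of the tangent space are then pointwise, and its
  topology is the one for which \<open>v \<mapsto> v c\<close> is an isomorphism onto the model space.
\<close>

type_synonym ('x, 'a) tvec = "('x, 'a) chart \<Rightarrow> 'a"

definition tangent_space ::
  "('x, 'a::banach) chart set \<Rightarrow> 'x \<Rightarrow> ('x, 'a) tvec set" where
  "tangent_space A x = {v.
     (\<forall>c\<in>A. \<forall>d\<in>A. x \<in> fst c \<longrightarrow> x \<in> fst d \<longrightarrow>
        v d = frechet_derivative (snd d \<circ> chart_inv c) (at (snd c x)) (v c)) \<and>
     (\<forall>c. \<not> (c \<in> A \<and> x \<in> fst c) \<longrightarrow> v c = 0)}"

definition tscale :: "real \<Rightarrow> ('x, 'a::real_vector) tvec \<Rightarrow> ('x, 'a) tvec" where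
  "tscale s v = (\<lambda>c. s *\<^sub>R v c)"

definition differentiable_into ::
  "('x, 'a::banach) chart set \<Rightarrow> ('x \<Rightarrow> 'b::real_normed_vector) \<Rightarrow> 'x \<Rightarrow> bool" where
  "differentiable_into A f x \<longleftrightarrow>
     (\<forall>c\<in>A. x \<in> fst c \<longrightarrow> (f \<circ> chart_inv c) differentiable (at (snd c x)))"

text \<open>By the chain rule the derivatives below do not depend on the chart that is chosen.\<close>

definition derivative_into ::
  "('x, 'a::banach) chart set \<Rightarrow> ('x \<Rightarrow> 'b::real_normed_vector) \<Rightarrow> 'x \<Rightarrow> ('x, 'a) tvec \<Rightarrow> 'b" where
  "derivative_into A f x v =
     (let c = (SOME c. c \<in> A \<and> x \<in> fst c)
      in frechet_derivative (f \<circ> chart_inv c) (at (snd c x)) (v c))"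

definition manifold_differentiable_at ::
  "('x::topological_space, 'a::banach) chart set \<Rightarrow> ('z::topological_space, 'b::banach) chart set
   \<Rightarrow> ('x \<Rightarrow> 'z) \<Rightarrow> 'x \<Rightarrow> bool" where
  "manifold_differentiable_at A B f x \<longleftrightarrow>
     (f \<longlongrightarrow> f x) (at x) \<and> (\<forall>d\<in>B. f x \<in> fst d \<longrightarrow> differentiable_into A (snd d \<circ> f) x)"

definition tangent_map ::
  "('x, 'a::banach) chart set \<Rightarrow> ('z, 'b::banach) chart set
   \<Rightarrow> ('x \<Rightarrow> 'z) \<Rightarrow> 'x \<Rightarrow> ('x, 'a) tvec \<Rightarrow> ('z, 'b) tvec" where
  "tangent_map A B f x v =
     (\<lambda>d. if d \<in> B \<and> f x \<in> fst d then derivative_into A (snd d \<circ> f) x v else 0)"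

text \<open>Curves are considered on a set \<open>S\<close> of parameters, so that one-sided derivatives are covered.\<close>

definition curve_differentiable_at ::
  "('x::topological_space, 'a::banach) chart set \<Rightarrow> (real \<Rightarrow> 'x) \<Rightarrow> real set \<Rightarrow> real \<Rightarrow> bool" where
  "curve_differentiable_at A \<gamma> S t \<longleftrightarrow>
     (\<gamma> \<longlongrightarrow> \<gamma> t) (at t within S) \<and>
     (\<forall>c\<in>A. \<gamma> t \<in> fst c \<longrightarrow> (snd c \<circ> \<gamma>) differentiable (at t within S))"

definition velocity ::
  "('x, 'a::banach) chart set \<Rightarrow> (real \<Rightarrow> 'x) \<Rightarrow> real set \<Rightarrow> real \<Rightarrow> ('x, 'a) tvec" where
  "velocity A \<gamma> S t =
     (\<lambda>c. if c \<in> A \<and> \<gamma> t \<in> fst c then vector_derivative (snd c \<circ> \<gamma>) (at t within S) else 0)"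


subsection \<open>Vector bundles of class $C^1$\<close>

text \<open>
  A pair \<open>(U, \<tau>)\<close> in \<open>trivs\<close> stands for the local trivialization \<open>e \<mapsto> (p e, \<tau> e)\<close> of the part of
  the bundle over \<open>U\<close>.
\<close>

record ('y, 'e, 'b) vbundle =
  proj :: "'e \<Rightarrow> 'y"
  fzero :: "'y \<Rightarrow> 'e"
  fadd :: "'e \<Rightarrow> 'e \<Rightarrow> 'e"
  fscale :: "real \<Rightarrow> 'e \<Rightarrow> 'e"
  trivs :: "('y set \<times> ('e \<Rightarrow> 'b)) set"

definition fibre :: "('y, 'e, 'b) vbundle \<Rightarrow> 'y \<Rightarrow> 'e set" where
  "fibre E y = proj E -` {y}"

text \<open>
  The vector space axioms for the fibres are not listed: they follow from the fact that the
  trivializations are fibrewise bijective and respect the operations.  The transition maps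
  \<open>\<tau>'\<^sub>y \<tau>\<^sub>y\<^sup>-\<^sup>1\<close> are required to be of class $C^1$ in \<open>y\<close> as elements \<open>G y\<close> of the Banach space of bounded
  linear operators.
\<close>

definition C1_vector_bundle ::
  "('y::topological_space, 'c::banach) chart set
   \<Rightarrow> ('y, 'e::topological_space, 'b::banach) vbundle \<Rightarrow> bool" where
  "C1_vector_bundle A E \<longleftrightarrow>
     continuous_on UNIV (proj E) \<and>
     (\<Union>t\<in>trivs E. fst t) = UNIV \<and>
     (\<forall>t\<in>trivs E. open (fst t) \<and>
        (\<exists>g. homeomorphism (proj E -` fst t) (fst t \<times> UNIV) (\<lambda>e. (proj E e, snd t e)) g)) \<and>
     (\<forall>y. fzero E y \<in> fibre E y \<and>
        (\<forall>e\<in>fibre E y. (\<forall>e'\<in>fibre E y. fadd E e e' \<in> fibre E y) \<and> (\<forall>s. fscale E s e \<in> fibre E y))) \<and>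
     (\<forall>t\<in>trivs E. \<forall>y\<in>fst t. snd t (fzero E y) = 0 \<and>
        (\<forall>e\<in>fibre E y. (\<forall>e'\<in>fibre E y. snd t (fadd E e e') = snd t e + snd t e') \<and>
           (\<forall>s. snd t (fscale E s e) = s *\<^sub>R snd t e))) \<and>
     (\<forall>t\<in>trivs E. \<forall>t'\<in>trivs E. \<exists>G :: 'y \<Rightarrow> 'b \<Rightarrow>\<^sub>L 'b.
        C1_into A (fst t \<inter> fst t') G \<and>
        (\<forall>e. proj E e \<in> fst t \<inter> fst t' \<longrightarrow> snd t' e = blinfun_apply (G (proj E e)) (snd t e)))"

text \<open>The manifold structure of the total space is the one defined by the local trivializations.\<close>

definition total_atlas ::
  "('y, 'c) chart set \<Rightarrow> ('y, 'e, 'b) vbundle \<Rightarrow> ('e, 'c \<times> 'b) chart set" where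
  "total_atlas A E = {(proj E -` (fst c \<inter> fst t), \<lambda>e. (snd c (proj E e), snd t e)) | c t.
     c \<in> A \<and> t \<in> trivs E}"

definition fibre_continuous_linear ::
  "('y, 'e, 'b::banach) vbundle \<Rightarrow> 'y \<Rightarrow> 'y \<Rightarrow> ('e \<Rightarrow> 'e) \<Rightarrow> bool" where
  "fibre_continuous_linear E y y' L \<longleftrightarrow>
     (\<forall>e\<in>fibre E y. L e \<in> fibre E y') \<and>
     (\<forall>t\<in>trivs E. \<forall>t'\<in>trivs E. y \<in> fst t \<longrightarrow> y' \<in> fst t' \<longrightarrow>
        (\<exists>l. bounded_linear l \<and> (\<forall>e\<in>fibre E y. snd t' (L e) = l (snd t e))))"

text \<open>
  Derivative of a map from a manifold into the fixed fibre over \<open>y\<close>, which is a Banach space by way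
  of any trivialization around \<open>y\<close>; the tangent spaces of the fibre are identified with the fibre.
\<close>

definition derivative_into_fibre ::
  "('x, 'a::banach) chart set \<Rightarrow> ('y, 'e, 'b::banach) vbundle \<Rightarrow> 'y
   \<Rightarrow> ('x \<Rightarrow> 'e) \<Rightarrow> 'x \<Rightarrow> ('x, 'a) tvec \<Rightarrow> 'e" where
  "derivative_into_fibre A E y f x v =
     (let t = (SOME t. t \<in> trivs E \<and> y \<in> fst t)
      in inv_into (fibre E y) (snd t) (derivative_into A (snd t \<circ> f) x v))"


subsection \<open>Connection maps and vector back-transports\<close>

definition vertical_lift ::
  "('y, 'c::banach) chart set \<Rightarrow> ('y, 'e, 'b::banach) vbundle \<Rightarrow> 'e \<Rightarrow> 'e \<Rightarrow> ('e, 'c \<times> 'b) tvec" where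
  "vertical_lift A E e w = velocity (total_atlas A E) (\<lambda>t. fadd E e (fscale E t w)) UNIV 0"

text \<open>
  Continuous linear maps from \<open>T\<^sub>eE\<close> to the fibre are those that are bounded linear in coordinates: the
  chart \<open>c\<close> identifies \<open>T\<^sub>eE\<close>, and the trivialization \<open>t\<close> the fibre, with the respective Banach space.
\<close>

definition connection_map ::
  "('y, 'c::banach) chart set \<Rightarrow> ('y, 'e, 'b::banach) vbundle
   \<Rightarrow> ('e \<Rightarrow> ('e, 'c \<times> 'b) tvec \<Rightarrow> 'e) \<Rightarrow> bool" where
  "connection_map A E Q \<longleftrightarrow>
     (\<forall>e. (\<forall>v\<in>tangent_space (total_atlas A E) e. Q e v \<in> fibre E (proj E e)) \<and>
        (\<forall>c\<in>total_atlas A E. \<forall>t\<in>trivs E. e \<in> fst c \<longrightarrow> proj E e \<in> fst t \<longrightarrow>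
           (\<exists>l. bounded_linear l \<and>
              (\<forall>v\<in>tangent_space (total_atlas A E) e. snd t (Q e v) = l (v c)))) \<and>
        (\<forall>w\<in>fibre E (proj E e). Q e (vertical_lift A E e w) = w))"

definition linear_connection_map ::
  "('y, 'c::banach) chart set \<Rightarrow> ('y, 'e, 'b::banach) vbundle
   \<Rightarrow> ('e \<Rightarrow> ('e, 'c \<times> 'b) tvec \<Rightarrow> 'e) \<Rightarrow> bool" where
  "linear_connection_map A E Q \<longleftrightarrow>
     connection_map A E Q \<and>
     (\<forall>s e. \<forall>v\<in>tangent_space (total_atlas A E) e.
        Q (fscale E s e) (tangent_map (total_atlas A E) (total_atlas A E) (fscale E s) e v)
          = fscale E s (Q e v))"

text \<open>
  By the bounded inverse theorem, a bijective element of $L(E_{\hat y}, E_y)$ has a continuous inverse.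
  The operator \<open>G y'\<close> below is $\tau_y V_y(\hat y) \tau_{\hat y}^{-1}$ with $\hat y$ = \<open>y'\<close>.
\<close>

definition back_transport ::
  "('y, 'c::banach) chart set \<Rightarrow> ('y, 'e, 'b::banach) vbundle \<Rightarrow> 'y \<Rightarrow> ('y \<Rightarrow> 'e \<Rightarrow> 'e) \<Rightarrow> bool" where
  "back_transport A E y V \<longleftrightarrow>
     (\<forall>y'. fibre_continuous_linear E y' y (V y') \<and> bij_betw (V y') (fibre E y') (fibre E y)) \<and>
     (\<forall>e\<in>fibre E y. V y e = e) \<and>
     (\<forall>t\<in>trivs E. \<forall>t'\<in>trivs E. y \<in> fst t \<longrightarrow>
        (\<exists>G :: 'y \<Rightarrow> 'b \<Rightarrow>\<^sub>L 'b. (\<forall>y'\<in>fst t'. differentiable_into A G y') \<and>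
           (\<forall>e. proj E e \<in> fst t' \<longrightarrow>
              snd t (V (proj E e) e) = blinfun_apply (G (proj E e)) (snd t' e))))"

definition transport_map :: "('y, 'e, 'b) vbundle \<Rightarrow> ('y \<Rightarrow> 'e \<Rightarrow> 'e) \<Rightarrow> 'e \<Rightarrow> 'e" where
  "transport_map E V e = V (proj E e) e"

definition consistent_at ::
  "('y, 'c::banach) chart set \<Rightarrow> ('y, 'e, 'b::banach) vbundle \<Rightarrow> 'y \<Rightarrow> ('y \<Rightarrow> 'e \<Rightarrow> 'e)
   \<Rightarrow> ('e \<Rightarrow> ('e, 'c \<times> 'b) tvec \<Rightarrow> 'e) \<Rightarrow> 'e \<Rightarrow> bool" where
  "consistent_at A E y V Q e \<longleftrightarrow>
     (\<forall>v\<in>tangent_space (total_atlas A E) e.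
        Q e v = derivative_into_fibre (total_atlas A E) E y (transport_map E V) e v)"


subsection \<open>Newton directions and Newton paths\<close>

definition newton_map ::
  "('x, 'a::banach) chart set \<Rightarrow> ('y, 'c::banach) chart set \<Rightarrow> ('y, 'e, 'b::banach) vbundle
   \<Rightarrow> ('e \<Rightarrow> ('e, 'c \<times> 'b) tvec \<Rightarrow> 'e) \<Rightarrow> ('x \<Rightarrow> 'e) \<Rightarrow> 'x \<Rightarrow> ('x, 'a) tvec \<Rightarrow> 'e" where
  "newton_map A A' E Q F x v = Q (F x) (tangent_map A (total_atlas A' E) F x v)"

definition newton_direction ::
  "('x, 'a::banach) chart set \<Rightarrow> ('y, 'c::banach) chart set \<Rightarrow> ('y, 'e, 'b::banach) vbundle
   \<Rightarrow> ('e \<Rightarrow> ('e, 'c \<times> 'b) tvec \<Rightarrow> 'e) \<Rightarrow> ('x \<Rightarrow> 'e) \<Rightarrow> 'x \<Rightarrow> ('x, 'a) tvec \<Rightarrow> bool" where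
  "newton_direction A A' E Q F x v \<longleftrightarrow>
     v \<in> tangent_space A x \<and> fadd E (newton_map A A' E Q F x v) (F x) = fzero E (proj E (F x))"

text \<open>In the remaining definitions \<open>x\<close> is the starting point $x(0)$.\<close>

definition first_newton_direction ::
  "('x, 'a::banach) chart set \<Rightarrow> ('y, 'c::banach) chart set \<Rightarrow> ('y, 'e, 'b::banach) vbundle
   \<Rightarrow> ('y \<Rightarrow> 'e \<Rightarrow> 'e) \<Rightarrow> ('x \<Rightarrow> 'e) \<Rightarrow> 'x \<Rightarrow> real \<Rightarrow> ('x, 'a) tvec \<Rightarrow> bool" where
  "first_newton_direction A A' E V F x \<alpha> v \<longleftrightarrow>
     v \<in> tangent_space A x \<and>
     fadd E
       (derivative_into_fibre (total_atlas A' E) E (proj E (F x)) (transport_map E V) (F x)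
          (tangent_map A (total_atlas A' E) F x v))
       (fscale E \<alpha> (F x)) = fzero E (proj E (F x))"

text \<open>\<open>S\<close> is the set of parameters where the path is defined.\<close>

definition algebraic_newton_path ::
  "('y, 'e, 'b) vbundle \<Rightarrow> ('y \<Rightarrow> 'e \<Rightarrow> 'e) \<Rightarrow> ('x \<Rightarrow> 'e) \<Rightarrow> 'x \<Rightarrow> real set \<Rightarrow> (real \<Rightarrow> 'x) \<Rightarrow> bool" where
  "algebraic_newton_path E V F x S \<gamma> \<longleftrightarrow>
     \<gamma> 0 = x \<and> S \<subseteq> {0..1} \<and>
     (\<forall>\<beta>\<in>S. transport_map E V (F (\<gamma> \<beta>)) = fscale E (1 - \<beta>) (F x))"

definition differential_newton_path ::
  "('x::topological_space, 'a::banach) chart set \<Rightarrow> ('y, 'c::banach) chart set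
   \<Rightarrow> ('y, 'e, 'b::banach) vbundle \<Rightarrow> ('e \<Rightarrow> ('e, 'c \<times> 'b) tvec \<Rightarrow> 'e) \<Rightarrow> ('x \<Rightarrow> 'e) \<Rightarrow> 'x
   \<Rightarrow> real set \<Rightarrow> (real \<Rightarrow> 'x) \<Rightarrow> bool" where
  "differential_newton_path A A' E Q F x S \<gamma> \<longleftrightarrow>
     \<gamma> 0 = x \<and>
     (\<forall>\<beta>\<in>S. curve_differentiable_at A \<gamma> S \<beta> \<and>
        fadd E (newton_map A A' E Q F (\<gamma> \<beta>) (velocity A \<gamma> S \<beta>)) (F (\<gamma> \<beta>))
          = fzero E (proj E (F (\<gamma> \<beta>))))"

end

theory Submission
  imports Defs
begin

text \<open>
  Choose a trivialization around \<open>proj E (F x)\<close>.  By consistency, the Newton operator becomes the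
  derivative at \<open>x\<close> of the transported map \<open>F\<close> into the model space, so both Newton equations are
  the same linear equation up to the factor \<open>\<alpha>\<close>, and injectivity of the operator identifies their
  solutions.  Differentiating the equation of the algebraic path at \<open>0\<close> shows that its velocity
  solves the Newton equation, while for the differential path this is its defining equation.
\<close>

subsection \<open>Chain rules on manifolds\<close>

text \<open>
  In contrast to \<^const>\<open>C1_atlas\<close>, neither continuity of the derivatives nor openness of the images
  is required: this is all that the chain rule needs.
\<close>

definition differentiable_atlas :: "('x::topological_space, 'a::banach) chart set \<Rightarrow> bool" where
  "differentiable_atlas A \<longleftrightarrow>
     (\<Union>c\<in>A. fst c) = UNIV \<and>
     (\<forall>c\<in>A. open (fst c) \<and> inj_on (snd c) (fst c)) \<and>
     (\<forall>c\<in>A. \<forall>p\<in>fst c. differentiable_into A (snd c) p)"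

section \<open>Atlases and inverse charts\<close>

lemma differentiable_intoD:
  assumes "differentiable_into A f p" "c \<in> A" "p \<in> fst c"
  shows "(f \<circ> chart_inv c) differentiable (at (snd c p))"
  using assms unfolding differentiable_into_def by blast

lemma differentiable_atlasD:
  assumes "differentiable_atlas A"
  shows "(\<Union>c\<in>A. fst c) = UNIV"
    and "c \<in> A \<Longrightarrow> open (fst c)"
    and "c \<in> A \<Longrightarrow> inj_on (snd c) (fst c)"
    and "c \<in> A \<Longrightarrow> p \<in> fst c \<Longrightarrow> differentiable_into A (snd c) p"
  using assms unfolding differentiable_atlas_def by blast+

lemma chart_inv_apply:
  assumes "inj_on (snd c) (fst c)" "p \<in> fst c"
  shows "chart_inv c (snd c p) = p"
  using assms by (simp add: chart_inv_def)

lemma C1_on_differentiable: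
  assumes "C1_on S f" "z \<in> S"
  shows "f differentiable (at z)"
  using assms unfolding C1_on_def differentiable_def by blast

lemma C1_atlasD:
  assumes "C1_atlas A"
  shows "(\<Union>c\<in>A. fst c) = UNIV"
    and "c \<in> A \<Longrightarrow> open (fst c)"
    and "c \<in> A \<Longrightarrow> open (snd c ` fst c)"
    and "c \<in> A \<Longrightarrow> homeomorphism (fst c) (snd c ` fst c) (snd c) (chart_inv c)"
    and "c \<in> A \<Longrightarrow> d \<in> A \<Longrightarrow> C1_on (snd c ` (fst c \<inter> fst d)) (snd d \<circ> chart_inv c)"
  using assms unfolding C1_atlas_def by blast+

lemma C1_atlas_inj_on:
  assumes "C1_atlas A" "c \<in> A"
  shows "inj_on (snd c) (fst c)"
proof -
  have "homeomorphism (fst c) (snd c ` fst c) (snd c) (chart_inv c)"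
    using assms by (rule C1_atlasD)
  then show ?thesis
    by (intro inj_on_inverseI) (rule homeomorphism_apply1)
qed

text \<open>Allows the base manifolds and the total space to share the lemmas on tangent vectors and
  curves.\<close>

lemma C1_atlas_imp_differentiable_atlas:
  assumes "C1_atlas A"
  shows "differentiable_atlas A"
proof -
  have "differentiable_into A (snd c) p" if "c \<in> A" "p \<in> fst c" for c p
    unfolding differentiable_into_def
  proof (intro ballI impI)
    fix d assume "d \<in> A" "p \<in> fst d"
    then have "C1_on (snd d ` (fst d \<inter> fst c)) (snd c \<circ> chart_inv d)"
      using assms that by (intro C1_atlasD)
    then show "(snd c \<circ> chart_inv d) differentiable (at (snd d p))"
      by (rule C1_on_differentiable) (use that \<open>p \<in> fst d\<close> in blast)
  qed
  then show ?thesis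
    using assms C1_atlas_inj_on[OF assms] C1_atlasD[OF assms]
    by (simp add: differentiable_atlas_def)
qed

lemma open_chart_image:
  assumes "C1_atlas A" "c \<in> A" "open W" "W \<subseteq> fst c"
  shows "open (snd c ` W)"
proof -
  note h = C1_atlasD(4)[OF assms(1,2)]
  have "openin (top_of_set (fst c)) W"
    using assms(4,3) by (rule open_subset)
  then have "openin (top_of_set (snd c ` fst c)) (snd c ` W)"
    by (rule homeomorphism_imp_open_map[OF h])
  then show ?thesis
    using C1_atlasD(3)[OF assms(1,2)] by (rule openin_open_trans)
qed

text \<open>The values of \<open>chart_inv c\<close> off the chart image are arbitrary. Since the
  chart is a homeomorphism onto an open set, it maps W to a neighbourhood of the image of p, on
  which the inverse is genuine. Derivatives at that point therefore see only meaningful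
  values.\<close>

lemma eventually_chart_inv:
  assumes "C1_atlas A" "c \<in> A" "open W" "W \<subseteq> fst c" "p \<in> W"
  shows "\<forall>\<^sub>F z in nhds (snd c p). z \<in> snd c ` W \<and> chart_inv c z \<in> W \<and> snd c (chart_inv c z) = z"
proof -
  have ev: "\<forall>\<^sub>F z in nhds (snd c p). z \<in> snd c ` W"
    using open_chart_image[OF assms(1-4)] assms(5) by (simp add: eventually_nhds_in_open)
  have W: "chart_inv c z \<in> W \<and> snd c (chart_inv c z) = z" if "z \<in> snd c ` W" for z
  proof -
    obtain q where q: "q \<in> W" "z = snd c q"
      using \<open>z \<in> snd c ` W\<close> by blast
    with chart_inv_apply[OF C1_atlas_inj_on[OF assms(1,2)]] assms(4) show ?thesis
      by (metis subsetD)
  qed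
  show ?thesis
    using ev by (rule eventually_mono) (use W in blast)
qed

text \<open>Common core of the chain rules: h will be a map read in a chart, or a curve on a
  parameter set S. As h stays in the domain of d near z, \<open>T \<circ> h\<close> agrees there
  with \<open>T \<circ> chart_inv d\<close> after \<open>snd d \<circ> h\<close>, and the ordinary
  chain rule applies.\<close>

lemma has_derivative_into_compose:
  fixes h :: "'z::real_normed_vector \<Rightarrow> 'x::topological_space"
  assumes inj: "inj_on (snd d) (fst d)" and "d \<in> B"
    and T: "differentiable_into B T (h z)"
    and h: "((snd d \<circ> h) has_derivative h') (at z within S)"
    and ev: "\<forall>\<^sub>F w in at z within S. h w \<in> fst d" and "z \<in> S" "h z \<in> fst d"
  shows "((T \<circ> h) has_derivative
           (\<lambda>v. frechet_derivative (T \<circ> chart_inv d) (at (snd d (h z))) (h' v))) (at z within S)"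
proof -
  let ?T = "T \<circ> chart_inv d"
  have "?T differentiable (at (snd d (h z)))"
    using T \<open>d \<in> B\<close> \<open>h z \<in> fst d\<close> by (rule differentiable_intoD)
  then have "(?T has_derivative frechet_derivative ?T (at (snd d (h z)))) (at ((snd d \<circ> h) z))"
    by (simp add: frechet_derivative_works)
  from has_derivative_compose[OF h this]
  have "((\<lambda>w. ?T ((snd d \<circ> h) w)) has_derivative
         (\<lambda>v. frechet_derivative ?T (at (snd d (h z))) (h' v))) (at z within S)" .
  moreover have "\<forall>\<^sub>F w in at z within S. ?T ((snd d \<circ> h) w) = (T \<circ> h) w"
    using ev by (rule eventually_mono) (simp add: chart_inv_apply[OF inj])
  ultimately show ?thesis
    by (rule has_derivative_transform_eventually)
      (simp_all add: chart_inv_apply[OF inj] \<open>z \<in> S\<close> \<open>h z \<in> fst d\<close>)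
qed

section \<open>Tangent maps and the chain rule\<close>

lemma tendsto_eventually_in_open:
  assumes "(f \<longlongrightarrow> f p) (at p)" "open W" "f p \<in> W"
  obtains W' where "open W'" "p \<in> W'" "\<And>q. q \<in> W' \<Longrightarrow> f q \<in> W"
proof -
  have "\<forall>\<^sub>F q in at p. f q \<in> W"
    using assms by (simp add: tendsto_def)
  then obtain W' where "open W'" "p \<in> W'" "\<forall>q\<in>W'. q \<noteq> p \<longrightarrow> f q \<in> W"
    by (auto simp: eventually_at_topological)
  with that \<open>f p \<in> W\<close> show thesis by metis
qed

text \<open>Names the choice hidden in \<open>derivative_into\<close>.\<close>

definition chart_at :: "('x, 'a) chart set \<Rightarrow> 'x \<Rightarrow> ('x, 'a) chart" where
  "chart_at A p = (SOME c. c \<in> A \<and> p \<in> fst c)"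

lemma chart_at:
  assumes "(\<Union>c\<in>A. fst c) = UNIV"
  shows "chart_at A p \<in> A" "p \<in> fst (chart_at A p)"
proof -
  have "\<exists>c. c \<in> A \<and> p \<in> fst c" using assms by blast
  then have "chart_at A p \<in> A \<and> p \<in> fst (chart_at A p)"
    unfolding chart_at_def by (rule someI_ex)
  then show "chart_at A p \<in> A" "p \<in> fst (chart_at A p)" by simp_all
qed

lemma derivative_into_chart_at:
  "derivative_into A f p v =
     frechet_derivative (f \<circ> chart_inv (chart_at A p)) (at (snd (chart_at A p) p)) (v (chart_at A p))"
  by (simp add: derivative_into_def chart_at_def Let_def)

text \<open>The charts c and d are left free: a free c yields differentiability of the composition,
  a free d the compatibility of tangent vectors, and the choices \<open>chart_at\<close> yield the
  formula for \<open>derivative_into\<close>.\<close>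

lemma differentiable_into_compose:
  assumes "C1_atlas A" "differentiable_atlas B" "manifold_differentiable_at A B f p"
    and T: "differentiable_into B T (f p)" and "c \<in> A" "p \<in> fst c" "d \<in> B" "f p \<in> fst d"
  shows "((T \<circ> f \<circ> chart_inv c) has_derivative
     (\<lambda>w. frechet_derivative (T \<circ> chart_inv d) (at (snd d (f p)))
        (frechet_derivative (snd d \<circ> f \<circ> chart_inv c) (at (snd c p)) w))) (at (snd c p))"
proof -
  have inv: "chart_inv c (snd c p) = p"
    using C1_atlas_inj_on[OF assms(1,5)] assms(6) by (rule chart_inv_apply)
  have "open (fst d)" and inj: "inj_on (snd d) (fst d)"
    using assms(2,7) by (rule differentiable_atlasD)+
  \<comment> \<open>Differentiability of \<open>snd d \<circ> f\<close> alone does not keep f inside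
    \<open>fst d\<close>, because chart values outside the domain are arbitrary. Continuity of f at
    p does.\<close>
  obtain W where W: "open W" "p \<in> W" "\<And>q. q \<in> W \<Longrightarrow> f q \<in> fst d"
    using tendsto_eventually_in_open \<open>open (fst d)\<close> assms(3,8)
    unfolding manifold_differentiable_at_def by metis
  have "open (W \<inter> fst c)"
    using W(1) C1_atlasD(2)[OF assms(1,5)] by (rule open_Int)
  from eventually_chart_inv[OF assms(1,5) this, of p] assms(6) W(2)
  have "\<forall>\<^sub>F z in nhds (snd c p). (f \<circ> chart_inv c) z \<in> fst d"
    by (auto intro: W(3) elim!: eventually_mono)
  then have ev: "\<forall>\<^sub>F z in at (snd c p). (f \<circ> chart_inv c) z \<in> fst d"
    unfolding eventually_at_filter by (rule eventually_mono) simp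
  have "differentiable_into A (snd d \<circ> f) p"
    using assms(3,7,8) unfolding manifold_differentiable_at_def by blast
  from differentiable_intoD[OF this assms(5,6)]
  have "(snd d \<circ> (f \<circ> chart_inv c)) differentiable (at (snd c p))"
    by (simp add: comp_assoc)
  then have "((snd d \<circ> (f \<circ> chart_inv c)) has_derivative
      frechet_derivative (snd d \<circ> (f \<circ> chart_inv c)) (at (snd c p))) (at (snd c p))"
    by (simp add: frechet_derivative_works)
  from has_derivative_into_compose[where h = "f \<circ> chart_inv c", OF inj \<open>d \<in> B\<close> _ this ev, of T]
    T \<open>f p \<in> fst d\<close>
  show ?thesis
    by (simp add: inv comp_assoc)
qed

text \<open>The compatibility condition between charts d and e of B is the chain rule with T =
  \<open>snd e\<close>. Only the component of v in \<open>chart_at A p\<close> enters, so v is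
  arbitrary.\<close>

lemma tangent_map_in_tangent_space:
  assumes "C1_atlas A" "differentiable_atlas B" "manifold_differentiable_at A B f p"
  shows "tangent_map A B f p v \<in> tangent_space B (f p)"
proof -
  have c: "chart_at A p \<in> A" "p \<in> fst (chart_at A p)"
    using C1_atlasD(1)[OF assms(1)] by (rule chart_at)+
  have "tangent_map A B f p v e =
     frechet_derivative (snd e \<circ> chart_inv d) (at (snd d (f p))) (tangent_map A B f p v d)"
    if "d \<in> B" "e \<in> B" "f p \<in> fst d" "f p \<in> fst e" for d e
  proof -
    have "differentiable_into B (snd e) (f p)"
      using assms(2) that(2,4) by (rule differentiable_atlasD)
    from frechet_derivative_at[OF differentiable_into_compose[OF assms this c that(1,3)]]
    show ?thesis
      using that by (simp add: tangent_map_def derivative_into_chart_at fun_eq_iff)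
  qed
  moreover have "tangent_map A B f p v d = 0" if "\<not> (d \<in> B \<and> f p \<in> fst d)" for d
    using that by (auto simp: tangent_map_def)
  ultimately show ?thesis
    unfolding tangent_space_def by blast
qed

text \<open>For f = F and T the trivialized transport map, this turns the operator of the first
  Newton direction into the derivative of a single map from the manifold into a Banach
  space.\<close>

lemma derivative_into_compose:
  assumes "C1_atlas A" "differentiable_atlas B" "manifold_differentiable_at A B f p"
    and T: "differentiable_into B T (f p)"
  shows "differentiable_into A (T \<circ> f) p"
    and "derivative_into A (T \<circ> f) p v = derivative_into B T (f p) (tangent_map A B f p v)"
proof -
  have c: "chart_at A p \<in> A" "p \<in> fst (chart_at A p)"
    using C1_atlasD(1)[OF assms(1)] by (rule chart_at)+
  have d: "chart_at B (f p) \<in> B" "f p \<in> fst (chart_at B (f p))"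
    using differentiable_atlasD(1)[OF assms(2)] by (rule chart_at)+
  show "differentiable_into A (T \<circ> f) p"
    unfolding differentiable_into_def differentiable_def
    using differentiable_into_compose[OF assms _ _ d] by blast
  show "derivative_into A (T \<circ> f) p v = derivative_into B T (f p) (tangent_map A B f p v)"
    using frechet_derivative_at[OF differentiable_into_compose[OF assms c d]] d
    by (simp add: derivative_into_chart_at tangent_map_def fun_eq_iff)
qed

section \<open>Scaling of tangent vectors and velocities of curves\<close>

lemma derivative_into_tscale:
  assumes "(\<Union>c\<in>A. fst c) = UNIV" "differentiable_into A f p"
  shows "derivative_into A f p (tscale s v) = s *\<^sub>R derivative_into A f p v"
proof -
  have "(f \<circ> chart_inv (chart_at A p)) differentiable (at (snd (chart_at A p) p))"
    using assms(2) chart_at[OF assms(1)] by (rule differentiable_intoD)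
  then show ?thesis
    by (simp add: derivative_into_chart_at tscale_def linear_cmul linear_frechet_derivative)
qed

lemma tscale_in_tangent_space:
  assumes "differentiable_atlas A" "v \<in> tangent_space A p"
  shows "tscale s v \<in> tangent_space A p"
proof -
  have "tscale s v d = frechet_derivative (snd d \<circ> chart_inv c) (at (snd c p)) (tscale s v c)"
    if "c \<in> A" "d \<in> A" "p \<in> fst c" "p \<in> fst d" for c d
  proof -
    have "v d = frechet_derivative (snd d \<circ> chart_inv c) (at (snd c p)) (v c)"
      using assms(2) that unfolding tangent_space_def by blast
    moreover have "(snd d \<circ> chart_inv c) differentiable (at (snd c p))"
      using differentiable_atlasD(4)[OF assms(1) that(2,4)] that(1,3) by (rule differentiable_intoD)
    ultimately show ?thesis
      by (simp add: tscale_def linear_cmul[OF linear_frechet_derivative])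
  qed
  moreover have "tscale s v c = 0" if "\<not> (c \<in> A \<and> p \<in> fst c)" for c
  proof -
    have "v c = 0"
      using assms(2) that unfolding tangent_space_def by blast
    then show ?thesis
      by (simp add: tscale_def)
  qed
  ultimately show ?thesis
    unfolding tangent_space_def by blast
qed

text \<open>The core chain rule with h the curve: its derivative sends r to r times the velocity,
  and linearity of the outer derivative pulls r out. The free chart c serves to compare the
  components of the velocity.\<close>

lemma curve_has_vector_derivative:
  assumes A: "differentiable_atlas A" and \<gamma>: "curve_differentiable_at A \<gamma> S t" and "t \<in> S"
    and T: "differentiable_into A T (\<gamma> t)" and c: "c \<in> A" "\<gamma> t \<in> fst c"
  shows "((T \<circ> \<gamma>) has_vector_derivative
     frechet_derivative (T \<circ> chart_inv c) (at (snd c (\<gamma> t))) (velocity A \<gamma> S t c)) (at t within S)"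
proof -
  have "open (fst c)" and inj: "inj_on (snd c) (fst c)"
    using A c(1) by (rule differentiable_atlasD)+
  then have ev: "\<forall>\<^sub>F r in at t within S. \<gamma> r \<in> fst c"
    using \<gamma> c(2) unfolding curve_differentiable_at_def tendsto_def by blast
  have "(snd c \<circ> \<gamma>) differentiable (at t within S)"
    using \<gamma> c unfolding curve_differentiable_at_def by blast
  then have "((snd c \<circ> \<gamma>) has_derivative (\<lambda>r. r *\<^sub>R velocity A \<gamma> S t c)) (at t within S)"
    using c by (simp add: velocity_def vector_derivative_works has_vector_derivative_def)
  note has_derivative_into_compose[OF inj c(1) T this ev \<open>t \<in> S\<close> c(2)]
  moreover have "(T \<circ> chart_inv c) differentiable (at (snd c (\<gamma> t)))"
    using T c by (rule differentiable_intoD)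
  ultimately show ?thesis
    by (simp add: has_vector_derivative_def linear_cmul linear_frechet_derivative)
qed

text \<open>The chain rule with T a second chart gives one derivative of the curve in that chart. As
  t is not isolated in S, this derivative is unique and hence the value returned by
  \<open>vector_derivative\<close>.\<close>

lemma velocity_in_tangent_space:
  assumes "differentiable_atlas A" "curve_differentiable_at A \<gamma> S t" "t \<in> S"
    and "at t within S \<noteq> bot"
  shows "velocity A \<gamma> S t \<in> tangent_space A (\<gamma> t)"
proof -
  have "velocity A \<gamma> S t d = frechet_derivative (snd d \<circ> chart_inv c) (at (snd c (\<gamma> t)))
      (velocity A \<gamma> S t c)"
    if "c \<in> A" "d \<in> A" "\<gamma> t \<in> fst c" "\<gamma> t \<in> fst d" for c d
  proof -
    have "differentiable_into A (snd d) (\<gamma> t)"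
      using assms(1) that(2,4) by (rule differentiable_atlasD)
    from curve_has_vector_derivative[OF assms(1-3) this that(1,3)]
    have "vector_derivative (snd d \<circ> \<gamma>) (at t within S) =
       frechet_derivative (snd d \<circ> chart_inv c) (at (snd c (\<gamma> t))) (velocity A \<gamma> S t c)"
      using assms(4) by (simp add: vector_derivative_within)
    then show ?thesis
      using that by (simp add: velocity_def)
  qed
  moreover have "velocity A \<gamma> S t c = 0" if "\<not> (c \<in> A \<and> \<gamma> t \<in> fst c)" for c
    using that by (auto simp: velocity_def)
  ultimately show ?thesis
    unfolding tangent_space_def by blast
qed

lemma curve_has_vector_derivative_into:
  assumes "differentiable_atlas A" "curve_differentiable_at A \<gamma> S t" "t \<in> S"
    and "differentiable_into A T (\<gamma> t)"
  shows "((T \<circ> \<gamma>) has_vector_derivative derivative_into A T (\<gamma> t) (velocity A \<gamma> S t)) (at t within S)"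
  unfolding derivative_into_chart_at
  using assms by (intro curve_has_vector_derivative chart_at differentiable_atlasD(1))


subsection \<open>The total space of a vector bundle\<close>

lemma bundle_transition:
  fixes E :: "('y::topological_space, 'e::topological_space, 'b::banach) vbundle"
  assumes "C1_vector_bundle A E" "t \<in> trivs E" "t' \<in> trivs E"
  obtains G :: "'y \<Rightarrow> 'b \<Rightarrow>\<^sub>L 'b" where "C1_into A (fst t \<inter> fst t') G"
    "\<And>e. proj E e \<in> fst t \<inter> fst t' \<Longrightarrow> snd t' e = blinfun_apply (G (proj E e)) (snd t e)"
proof -
  have "\<forall>t\<in>trivs E. \<forall>t'\<in>trivs E. \<exists>G :: 'y \<Rightarrow> 'b \<Rightarrow>\<^sub>L 'b. C1_into A (fst t \<inter> fst t') G \<and>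
      (\<forall>e. proj E e \<in> fst t \<inter> fst t' \<longrightarrow> snd t' e = blinfun_apply (G (proj E e)) (snd t e))"
    using assms(1) unfolding C1_vector_bundle_def by (elim conjE)
  with assms(2,3) that show thesis by blast
qed

text \<open>The homeomorphism g inverts a map whose first component is the projection, so its slice
  over y takes values in the fibre and inverts the trivialization there.\<close>

lemma bundle_trivialization:
  assumes "C1_vector_bundle A E" "t \<in> trivs E" "y \<in> fst t"
  shows "bij_betw (snd t) (fibre E y) UNIV"
proof -
  obtain g where g: "homeomorphism (proj E -` fst t) (fst t \<times> UNIV) (\<lambda>e. (proj E e, snd t e)) g"
    using assms by (auto simp: C1_vector_bundle_def)
  show ?thesis
  proof (rule bij_betw_byWitness[where f' = "\<lambda>b. g (y, b)"])
    show "\<forall>e\<in>fibre E y. g (y, snd t e) = e"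
      using homeomorphism_apply1[OF g] assms(3) by (auto simp: fibre_def)
    have *: "(proj E (g (y, b)), snd t (g (y, b))) = (y, b)" for b
      using homeomorphism_apply2[OF g, of "(y, b)"] assms(3) by simp
    then show "\<forall>b\<in>UNIV. snd t (g (y, b)) = b" by simp
    show "(\<lambda>b. g (y, b)) ` UNIV \<subseteq> fibre E y"
      using * by (auto simp: fibre_def)
  qed simp
qed

text \<open>Transfers Newton equations from the fibre, which is not a type with vector operations,
  to the model space.\<close>

lemma fibre_sum_eq_fzero_iff:
  assumes E: "C1_vector_bundle A E" and t: "t \<in> trivs E" "y \<in> fst t"
    and e: "e \<in> fibre E y" "e' \<in> fibre E y"
  shows "fadd E e e' = fzero E y \<longleftrightarrow> snd t e + snd t e' = 0"
proof -
  have "fadd E e e' \<in> fibre E y" "fzero E y \<in> fibre E y"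
    using E e by (auto simp: C1_vector_bundle_def)
  then have "fadd E e e' = fzero E y \<longleftrightarrow> snd t (fadd E e e') = snd t (fzero E y)"
    using bundle_trivialization[OF E t] by (metis bij_betw_imp_inj_on inj_onD)
  also have "\<dots> \<longleftrightarrow> snd t e + snd t e' = 0"
    using E t e by (simp add: C1_vector_bundle_def)
  finally show ?thesis .
qed

text \<open>The first coordinate determines the base point; on the fibre over it the second
  coordinate is injective.\<close>

lemma total_chart_inj_on:
  assumes A: "C1_atlas A" and E: "C1_vector_bundle A E" and "c \<in> A" "t \<in> trivs E"
  shows "inj_on (\<lambda>e. (snd c (proj E e), snd t e)) (proj E -` (fst c \<inter> fst t))"
proof (rule inj_onI)
  fix e e'
  assume e: "e \<in> proj E -` (fst c \<inter> fst t)" "e' \<in> proj E -` (fst c \<inter> fst t)"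
    and eq: "(snd c (proj E e), snd t e) = (snd c (proj E e'), snd t e')"
  then have "proj E e = proj E e'"
    using C1_atlas_inj_on[OF A \<open>c \<in> A\<close>] by (auto dest: inj_onD)
  then show "e = e'"
    using bundle_trivialization[OF E \<open>t \<in> trivs E\<close>, of "proj E e"] e eq
    by (auto simp: fibre_def bij_betw_def dest: inj_onD)
qed

text \<open>Describes the inverse of a total chart by its coordinates: the base chart gives the base
  point, surjectivity of the trivialization a fibre element over it, and injectivity of the total
  chart identifies this element with the inverse. The set W can be shrunk to the overlap with a
  second chart.\<close>

lemma eventually_total_chart_inv:
  fixes A :: "('y::topological_space, 'c::banach) chart set"
    and E :: "('y, 'e::topological_space, 'b::banach) vbundle"
  assumes A: "C1_atlas A" and E: "C1_vector_bundle A E" and c: "c \<in> A" and t: "t \<in> trivs E"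
    and W: "open W" "W \<subseteq> fst c \<inter> fst t" "proj E e \<in> W"
  defines "d \<equiv> (proj E -` (fst c \<inter> fst t), \<lambda>e. (snd c (proj E e), snd t e))"
  shows "\<forall>\<^sub>F w in nhds (snd d e). chart_inv c (fst w) \<in> W \<and>
     proj E (chart_inv d w) = chart_inv c (fst w) \<and> snd t (chart_inv d w) = snd w"
proof -
  have d: "proj E (chart_inv d w) = chart_inv c (fst w) \<and> snd t (chart_inv d w) = snd w"
    if w: "chart_inv c (fst w) \<in> W" "snd c (chart_inv c (fst w)) = fst w" for w
  proof -
    have "chart_inv c (fst w) \<in> fst t" using w W by blast
    from bundle_trivialization[OF E t this]
    obtain e where e: "e \<in> fibre E (chart_inv c (fst w))" "snd t e = snd w"
      by (metis UNIV_I bij_betw_imp_surj_on imageE)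
    then have "e \<in> fst d" "snd d e = w"
      using w W by (auto simp: d_def fibre_def prod_eq_iff)
    moreover have "inj_on (snd d) (fst d)"
      using total_chart_inj_on[OF A E c t] by (simp add: d_def)
    ultimately have "chart_inv d w = e"
      using chart_inv_apply[of d e] by simp
    with e show ?thesis by (simp add: fibre_def)
  qed
  \<comment> \<open>Continuity of the first projection pulls the neighbourhood statement for the
    base chart back to the product.\<close>
  have "filterlim fst (nhds (snd c (proj E e))) (nhds (snd d e))"
    using tendsto_fst[OF filterlim_ident, of "snd d e"] by (simp add: d_def)
  from eventually_compose_filterlim[OF eventually_chart_inv[OF A c W(1) _ W(3)] this]
  have "\<forall>\<^sub>F w in nhds (snd d e). chart_inv c (fst w) \<in> W \<and> snd c (chart_inv c (fst w)) = fst w"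
    using W(2) by (auto elim: eventually_mono)
  then show ?thesis
    by (rule eventually_mono) (use d in blast)
qed

section \<open>Chart changes of the total space and the transported map\<close>

lemma differentiable_transform_eventually:
  assumes "f differentiable (at z)" "\<forall>\<^sub>F w in nhds z. f w = g w"
  shows "g differentiable (at z)"
proof -
  obtain f' where "(f has_derivative f') (at z)"
    using assms(1) by (auto simp: differentiable_def)
  then have "(g has_derivative f') (at z)"
    by (rule has_derivative_transform_eventually)
      (use assms(2) in \<open>auto simp: eventually_at_filter elim: eventually_mono dest: eventually_nhds_x_imp_x\<close>)
  then show ?thesis by (auto simp: differentiable_def)
qed

text \<open>In coordinates f is the evaluation of an operator, differentiable in the first
  coordinate, at the second one, so the product rule for the bounded bilinear
  \<open>blinfun_apply\<close> applies. G will be a transition map of the bundle or a trivialized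
  back-transport.\<close>

lemma total_chart_differentiable:
  fixes A :: "('y::topological_space, 'c::banach) chart set"
    and E :: "('y, 'e::topological_space, 'b::banach) vbundle"
    and G :: "'y \<Rightarrow> 'b \<Rightarrow>\<^sub>L 'd::real_normed_vector"
  assumes A: "C1_atlas A" and E: "C1_vector_bundle A E" and c: "c \<in> A" and t: "t \<in> trivs E"
    and W: "open W" "W \<subseteq> fst c \<inter> fst t" "proj E e \<in> W"
    and G: "(G \<circ> chart_inv c) differentiable (at (snd c (proj E e)))"
    and f: "\<And>e. proj E e \<in> W \<Longrightarrow> f e = blinfun_apply (G (proj E e)) (snd t e)"
  defines "d \<equiv> (proj E -` (fst c \<inter> fst t), \<lambda>e. (snd c (proj E e), snd t e))"
  shows "(f \<circ> chart_inv d) differentiable (at (snd d e))"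
proof -
  obtain G' where "((G \<circ> chart_inv c) has_derivative G') (at (fst (snd d e)))"
    using G by (auto simp: differentiable_def d_def)
  then have "((\<lambda>w. (G \<circ> chart_inv c) (fst w)) has_derivative (\<lambda>w. G' (fst w))) (at (snd d e))"
    by (rule has_derivative_compose[OF has_derivative_fst[OF has_derivative_ident]])
  from bounded_bilinear.FDERIV[OF bounded_bilinear_blinfun_apply this
      has_derivative_snd[OF has_derivative_ident]]
  have "(\<lambda>w. blinfun_apply ((G \<circ> chart_inv c) (fst w)) (snd w)) differentiable (at (snd d e))"
    by (auto simp: differentiable_def)
  then show ?thesis
    by (rule differentiable_transform_eventually)
      (use eventually_total_chart_inv[OF A E c t W] in
        \<open>auto simp: d_def f elim!: eventually_mono\<close>)
qed

lemma total_atlas_differentiable_atlas: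
  fixes A :: "('y::topological_space, 'c::banach) chart set"
    and E :: "('y, 'e::topological_space, 'b::banach) vbundle"
  assumes A: "C1_atlas A" and E: "C1_vector_bundle A E"
  shows "differentiable_atlas (total_atlas A E)"
  unfolding differentiable_atlas_def
proof (intro conjI ballI)
  have "e \<in> (\<Union>d\<in>total_atlas A E. fst d)" for e
  proof -
    have "proj E e \<in> (\<Union>c\<in>A. fst c)" "proj E e \<in> (\<Union>t\<in>trivs E. fst t)"
      using E unfolding C1_atlasD(1)[OF A] C1_vector_bundle_def by blast+
    then obtain c t where ct: "c \<in> A" "t \<in> trivs E" "proj E e \<in> fst c \<inter> fst t"
      by blast
    then have "(proj E -` (fst c \<inter> fst t), \<lambda>e. (snd c (proj E e), snd t e)) \<in> total_atlas A E"
      unfolding total_atlas_def by blast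
    then show ?thesis
      by (rule UN_I) (use ct in simp)
  qed
  then show "(\<Union>d\<in>total_atlas A E. fst d) = UNIV"
    by blast
next
  fix d assume "d \<in> total_atlas A E"
  then obtain c t where d: "c \<in> A" "t \<in> trivs E"
    "d = (proj E -` (fst c \<inter> fst t), \<lambda>e. (snd c (proj E e), snd t e))"
    by (auto simp: total_atlas_def)
  have "open (fst c \<inter> fst t)" "continuous_on UNIV (proj E)"
    using A E d by (auto simp: C1_atlasD C1_vector_bundle_def)
  then show "open (fst d)"
    by (simp only: d fst_conv open_vimage)
  show "inj_on (snd d) (fst d)"
    using total_chart_inj_on[OF A E d(1,2)] d(3) by simp
next
  fix d' e assume "d' \<in> total_atlas A E" and e': "e \<in> fst d'"
  then obtain c' t' where d': "c' \<in> A" "t' \<in> trivs E"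
    "d' = (proj E -` (fst c' \<inter> fst t'), \<lambda>e. (snd c' (proj E e), snd t' e))"
    by (auto simp: total_atlas_def)
  show "differentiable_into (total_atlas A E) (snd d') e"
    unfolding differentiable_into_def
  proof (intro ballI impI)
    fix d assume "d \<in> total_atlas A E" and e: "e \<in> fst d"
    then obtain c t where d: "c \<in> A" "t \<in> trivs E"
      "d = (proj E -` (fst c \<inter> fst t), \<lambda>e. (snd c (proj E e), snd t e))"
      by (auto simp: total_atlas_def)
    let ?W = "fst c \<inter> fst t \<inter> (fst c' \<inter> fst t')"
    have W: "open ?W" "?W \<subseteq> fst c \<inter> fst t" "proj E e \<in> ?W"
      using A E d d' e e' by (auto simp: C1_atlasD C1_vector_bundle_def intro!: open_Int)
    \<comment> \<open>The fibre component of the chart change applies the transition operator G,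
      which depends on the base point, to the fibre coordinate.\<close>
    obtain G :: "'y \<Rightarrow> 'b \<Rightarrow>\<^sub>L 'b" where G: "C1_into A (fst t \<inter> fst t') G"
      "\<And>e. proj E e \<in> fst t \<inter> fst t' \<Longrightarrow> snd t' e = blinfun_apply (G (proj E e)) (snd t e)"
      using bundle_transition[OF E d(2) d'(2)] by blast
    have "C1_on (snd c ` (fst c \<inter> (fst t \<inter> fst t'))) (G \<circ> chart_inv c)"
      using G(1) d(1) by (simp add: C1_into_def)
    then have "(G \<circ> chart_inv c) differentiable (at (snd c (proj E e)))"
      by (rule C1_on_differentiable) (use W in auto)
    from total_chart_differentiable[OF A E d(1,2) W this G(2)]
    have 2: "(snd t' \<circ> chart_inv d) differentiable (at (snd d e))"
      by (simp add: d(3))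
    \<comment> \<open>Near the point considered, the base component of the chart change is the chart
      change of the base after \<open>fst\<close>.\<close>
    have "C1_on (snd c ` (fst c \<inter> fst c')) (snd c' \<circ> chart_inv c)"
      using A d(1) d'(1) by (rule C1_atlasD)
    then have "(snd c' \<circ> chart_inv c) differentiable (at (snd c (proj E e)))"
      by (rule C1_on_differentiable) (use W in auto)
    then have "(snd c' \<circ> chart_inv c) differentiable (at (fst (snd d e)))"
      by (simp add: d(3))
    then have "(\<lambda>w. (snd c' \<circ> chart_inv c) (fst w)) differentiable (at (snd d e))"
      by (rule differentiable_compose[OF _ bounded_linear_imp_differentiable[OF bounded_linear_fst]])
    then have 1: "(\<lambda>w. snd c' (proj E (chart_inv d w))) differentiable (at (snd d e))"
      by (rule differentiable_transform_eventually)
        (use eventually_total_chart_inv[OF A E d(1,2) W] in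
          \<open>auto simp: d(3) elim!: eventually_mono\<close>)
    from 1 2 obtain D1 D2 where
      "((\<lambda>w. snd c' (proj E (chart_inv d w))) has_derivative D1) (at (snd d e))"
      "((snd t' \<circ> chart_inv d) has_derivative D2) (at (snd d e))"
      unfolding differentiable_def by blast
    from differentiableI[OF has_derivative_Pair[OF this]]
    show "(snd d' \<circ> chart_inv d) differentiable (at (snd d e))"
      by (simp add: d'(3) comp_def)
  qed
qed

text \<open>Differentiability of the back-transport provides an operator G with the same coordinate
  form as a bundle transition.\<close>

lemma transport_map_differentiable:
  fixes A :: "('y::topological_space, 'c::banach) chart set"
    and E :: "('y, 'e::topological_space, 'b::banach) vbundle"
  assumes A: "C1_atlas A" and E: "C1_vector_bundle A E" and V: "back_transport A E y V"
    and t: "t \<in> trivs E" "y \<in> fst t"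
  shows "differentiable_into (total_atlas A E) (snd t \<circ> transport_map E V) e"
  unfolding differentiable_into_def
proof (intro ballI impI)
  fix d assume "d \<in> total_atlas A E" and e: "e \<in> fst d"
  then obtain c s where d: "c \<in> A" "s \<in> trivs E"
    "d = (proj E -` (fst c \<inter> fst s), \<lambda>e. (snd c (proj E e), snd s e))"
    by (auto simp: total_atlas_def)
  have W: "open (fst c \<inter> fst s)" "fst c \<inter> fst s \<subseteq> fst c \<inter> fst s" "proj E e \<in> fst c \<inter> fst s"
    using A E d e by (auto simp: C1_atlasD C1_vector_bundle_def)
  obtain G :: "'y \<Rightarrow> 'b \<Rightarrow>\<^sub>L 'b" where G: "\<And>y'. y' \<in> fst s \<Longrightarrow> differentiable_into A G y'"
    "\<And>e. proj E e \<in> fst s \<Longrightarrow> snd t (V (proj E e) e) = blinfun_apply (G (proj E e)) (snd s e)"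
    using V t d(2) unfolding back_transport_def by blast
  have "(G \<circ> chart_inv c) differentiable (at (snd c (proj E e)))"
    using G(1)[of "proj E e"] W d(1) by (auto simp: differentiable_into_def)
  from total_chart_differentiable[OF A E d(1,2) W this, of "snd t \<circ> transport_map E V"] G(2)
  show "(snd t \<circ> transport_map E V \<circ> chart_inv d) differentiable (at (snd d e))"
    by (simp add: d(3) transport_map_def)
qed

text \<open>Exposes the very trivialization chosen inside \<open>derivative_into_fibre\<close>. With
  this t the inverse in the definition cancels, so independence of the choice need not be
  discussed.\<close>

lemma derivative_into_fibre_trivialization:
  assumes E: "C1_vector_bundle A E"
  obtains t where "t \<in> trivs E" "y \<in> fst t"
    "\<And>B f p v. derivative_into_fibre B E y f p v \<in> fibre E y"
    "\<And>B f p v. snd t (derivative_into_fibre B E y f p v) = derivative_into B (snd t \<circ> f) p v"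
proof -
  define t where "t = (SOME t. t \<in> trivs E \<and> y \<in> fst t)"
  have "y \<in> (\<Union>t\<in>trivs E. fst t)"
    using E by (simp add: C1_vector_bundle_def)
  then have "\<exists>t. t \<in> trivs E \<and> y \<in> fst t" by blast
  then have t: "t \<in> trivs E" "y \<in> fst t"
    unfolding t_def by (metis (mono_tags, lifting) someI_ex)+
  have img: "snd t ` fibre E y = UNIV"
    using bundle_trivialization[OF E t] by (rule bij_betw_imp_surj_on)
  show thesis
    by (rule that[OF t])
      (simp_all add: derivative_into_fibre_def Let_def img inv_into_into f_inv_into_f flip: t_def)
qed


subsection \<open>Newton directions and Newton paths\<close>

theorem lemma6p2:
  fixes AX :: "('x::topological_space, 'a::banach) chart set"
    and AY :: "('y::topological_space, 'c::banach) chart set"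
    and E :: "('y, 'e::topological_space, 'b::banach) vbundle"
    and F :: "'x \<Rightarrow> 'e"
    and Q :: "'e \<Rightarrow> ('e, 'c \<times> 'b) tvec \<Rightarrow> 'e"
    and V :: "'y \<Rightarrow> 'e \<Rightarrow> 'e"
    and x :: 'x
    and \<delta>x :: "('x, 'a) tvec"
    and \<alpha> :: real
  assumes "C1_atlas AX"
    and "C1_atlas AY"
    and "C1_vector_bundle AY E"
    and "\<forall>z. manifold_differentiable_at AX (total_atlas AY E) F z"
    and "linear_connection_map AY E Q"
    and "0 < \<alpha>" and "\<alpha> \<le> 1"
    and "bij_betw (newton_map AX AY E Q F x) (tangent_space AX x) (fibre E (proj E (F x)))"
    and "newton_direction AX AY E Q F x \<delta>x"
    and "back_transport AY E (proj E (F x)) V"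
    and "consistent_at AY E (proj E (F x)) V Q (F x)"
  shows "(\<forall>v. first_newton_direction AX AY E V F x \<alpha> v \<longleftrightarrow> v = tscale \<alpha> \<delta>x)
    \<and> (\<forall>\<epsilon> \<gamma>. 0 < \<epsilon> \<longrightarrow> algebraic_newton_path E V F x {0..<\<epsilon>} \<gamma>
          \<longrightarrow> curve_differentiable_at AX \<gamma> {0..<\<epsilon>} 0
          \<longrightarrow> tscale \<alpha> \<delta>x = tscale \<alpha> (velocity AX \<gamma> {0..<\<epsilon>} 0))
    \<and> (\<forall>\<epsilon> \<gamma>. 0 < \<epsilon> \<longrightarrow> differential_newton_path AX AY E Q F x {0..<\<epsilon>} \<gamma>
          \<longrightarrow> tscale \<alpha> \<delta>x = tscale \<alpha> (velocity AX \<gamma> {0..<\<epsilon>} 0))"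
proof -
  let ?y = "proj E (F x)" and ?M = "newton_map AX AY E Q F x" and ?TE = "total_atlas AY E"
  note AX = assms(1) and E = assms(3)
  have DX: "differentiable_atlas AX"
    using AX by (rule C1_atlas_imp_differentiable_atlas)
  have DE: "differentiable_atlas ?TE"
    using assms(2,3) by (rule total_atlas_differentiable_atlas)
  have F: "manifold_differentiable_at AX ?TE F x"
    using assms(4) by blast
  obtain t where t: "t \<in> trivs E" "?y \<in> fst t"
    and fib: "\<And>f p v. derivative_into_fibre ?TE E ?y f p v \<in> fibre E ?y"
    and triv: "\<And>f p v. snd t (derivative_into_fibre ?TE E ?y f p v) = derivative_into ?TE (snd t \<circ> f) p v"
    using derivative_into_fibre_trivialization[OF E, of ?y] by metis
  define T where "T = snd t \<circ> transport_map E V"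
  have T: "differentiable_into ?TE T (F x)"
    unfolding T_def by (rule transport_map_differentiable[OF assms(2) E assms(10) t])
  let ?D = "\<lambda>v. derivative_into_fibre ?TE E ?y (transport_map E V) (F x) (tangent_map AX ?TE F x v)"
  define L where "L = derivative_into AX (T \<circ> F) x"
  \<comment> \<open>Consistency speaks only about tangent vectors at \<open>F x\<close>; the tangent
    map of F produces such vectors.\<close>
  have M: "?M v = ?D v" for v
    using assms(11) tangent_map_in_tangent_space[OF AX DE F, of v]
    by (simp add: newton_map_def consistent_at_def)
  have LD: "snd t (?D v) = L v" for v
    by (simp add: triv L_def derivative_into_compose(2)[OF AX DE F T] flip: T_def)
  have TF: "differentiable_into AX (T \<circ> F) x"
    by (rule derivative_into_compose(1)[OF AX DE F T])
  have L_scale: "L (tscale s v) = s *\<^sub>R L v" for s v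
    unfolding L_def by (rule derivative_into_tscale[OF _ TF]) (rule C1_atlasD(1)[OF AX])
  have Fx: "F x \<in> fibre E ?y" "fscale E s (F x) \<in> fibre E ?y"
    "snd t (fscale E s (F x)) = s *\<^sub>R snd t (F x)" for s
    using E t by (auto simp: fibre_def C1_vector_bundle_def)
  have newton: "newton_direction AX AY E Q F x v \<longleftrightarrow> v \<in> tangent_space AX x \<and> L v + snd t (F x) = 0" for v
    by (simp add: newton_direction_def M LD fibre_sum_eq_fzero_iff[OF E t fib Fx(1)])
  have first: "first_newton_direction AX AY E V F x \<alpha> v \<longleftrightarrow>
      v \<in> tangent_space AX x \<and> L v + \<alpha> *\<^sub>R snd t (F x) = 0" for v
    by (simp add: first_newton_direction_def LD Fx(3) fibre_sum_eq_fzero_iff[OF E t fib Fx(2)])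
  \<comment> \<open>Equal values of L are lifted back to the fibre by injectivity of the
    trivialization; invertibility of the Newton operator then applies on the tangent space.\<close>
  have L_inj: "v = w" if "v \<in> tangent_space AX x" "w \<in> tangent_space AX x" "L v = L w" for v w
  proof -
    have "?D v = ?D w"
      using that(3) bundle_trivialization[OF E t] fib unfolding LD[symmetric]
      by (metis bij_betw_imp_inj_on inj_onD)
    then show ?thesis
      using that assms(8) M by (metis bij_betw_imp_inj_on inj_onD)
  qed
  have dx: "\<delta>x \<in> tangent_space AX x" "L \<delta>x = - snd t (F x)"
    using assms(9) by (simp_all add: newton eq_neg_iff_add_eq_0)
  \<comment> \<open>For both paths it therefore suffices to show that the initial velocity is a
    Newton direction.\<close>
  have unique: "v = \<delta>x" if "newton_direction AX AY E Q F x v" for v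
    using that dx by (intro L_inj) (auto simp: newton simp flip: eq_neg_iff_add_eq_0)
  \<comment> \<open>0 is the left endpoint of the parameter interval, so derivatives there are
    one-sided; they are unique because 0 is a limit point of the interval.\<close>
  have nontriv: "at (0::real) within {0..<\<epsilon>} \<noteq> bot" if "0 < \<epsilon>" for \<epsilon>
    using that by (simp add: trivial_limit_within islimpt_Ico)

  have "first_newton_direction AX AY E V F x \<alpha> v \<longleftrightarrow> v = tscale \<alpha> \<delta>x" for v
  proof
    assume "first_newton_direction AX AY E V F x \<alpha> v"
    then have "v \<in> tangent_space AX x" "L v = L (tscale \<alpha> \<delta>x)"
      by (simp_all add: first L_scale dx(2) flip: eq_neg_iff_add_eq_0)
    then show "v = tscale \<alpha> \<delta>x"
      by (intro L_inj tscale_in_tangent_space[OF DX dx(1)])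
  next
    assume "v = tscale \<alpha> \<delta>x"
    then show "first_newton_direction AX AY E V F x \<alpha> v"
      by (simp add: first L_scale dx tscale_in_tangent_space[OF DX])
  qed
  moreover have "velocity AX \<gamma> {0..<\<epsilon>} 0 = \<delta>x"
    if "0 < \<epsilon>" and path: "algebraic_newton_path E V F x {0..<\<epsilon>} \<gamma>"
      and \<gamma>: "curve_differentiable_at AX \<gamma> {0..<\<epsilon>} 0" for \<epsilon> \<gamma>
  proof -
    have \<gamma>0: "\<gamma> 0 = x" and 0: "0 \<in> {0..<\<epsilon>}"
      using path \<open>0 < \<epsilon>\<close> by (simp_all add: algebraic_newton_path_def)
    \<comment> \<open>In the trivialization the path equation makes the transported residual affine
      in \<beta>, so its derivative is explicit.\<close>
    have eq: "(T \<circ> F \<circ> \<gamma>) \<beta> = (1 - \<beta>) *\<^sub>R snd t (F x)" if "\<beta> \<in> {0..<\<epsilon>}" for \<beta>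
      using path that by (simp add: algebraic_newton_path_def T_def Fx)
    have deriv: "((\<lambda>\<beta>. (1 - \<beta>) *\<^sub>R snd t (F x)) has_vector_derivative - snd t (F x)) (at 0 within {0..<\<epsilon>})"
      by (auto intro!: derivative_eq_intros)
    have "((T \<circ> F \<circ> \<gamma>) has_vector_derivative - snd t (F x)) (at 0 within {0..<\<epsilon>})"
      using 0 eq deriv by (rule has_vector_derivative_transform)
    \<comment> \<open>The same curve, now differentiated by the chain rule; comparing the two values
      gives the Newton equation for the velocity.\<close>
    moreover have "((T \<circ> F \<circ> \<gamma>) has_vector_derivative L (velocity AX \<gamma> {0..<\<epsilon>} 0)) (at 0 within {0..<\<epsilon>})"
      using curve_has_vector_derivative_into[OF DX \<gamma> 0] TF by (simp add: L_def \<gamma>0)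
    ultimately have "L (velocity AX \<gamma> {0..<\<epsilon>} 0) = - snd t (F x)"
      using nontriv[OF \<open>0 < \<epsilon>\<close>] vector_derivative_unique_within by blast
    then show ?thesis
      using velocity_in_tangent_space[OF DX \<gamma> 0 nontriv[OF \<open>0 < \<epsilon>\<close>]]
      by (intro unique) (simp add: newton \<gamma>0)
  qed
  moreover have "velocity AX \<gamma> {0..<\<epsilon>} 0 = \<delta>x"
    if "0 < \<epsilon>" and path: "differential_newton_path AX AY E Q F x {0..<\<epsilon>} \<gamma>" for \<epsilon> \<gamma>
  proof -
    have 0: "0 \<in> {0..<\<epsilon>}" and \<gamma>: "curve_differentiable_at AX \<gamma> {0..<\<epsilon>} 0"
      using path \<open>0 < \<epsilon>\<close> by (simp_all add: differential_newton_path_def)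
    \<comment> \<open>At parameter 0, where the path is at x, its defining equation is the Newton
      equation for the velocity.\<close>
    show ?thesis
      using path 0 velocity_in_tangent_space[OF DX \<gamma> 0 nontriv[OF \<open>0 < \<epsilon>\<close>]]
      by (intro unique) (auto simp: newton_direction_def differential_newton_path_def)
  qed
  ultimately show ?thesis by simp
qed

end
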